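(* Let $\mathcal{C}_3$ denote the set of integers occurring as a coordinate of some 3-color fair game, i.e. of some triple of non-negative integers $(x_1,x_2,x_3)$ with $(x_1+x_2+x_3)^2-(x_1+x_2+x_3)-4(x_1x_2+x_1x_3+x_2x_3)=0$. Let $P_1^{\ge 0}$ be the set of positive integers all of whose prime factors are congruent to $1$ modulo $3$ (including $1$). Then $$\mathcal{C}_3=\{c\ge 0:\ 2c+1\in P_1^{\ge 0}\cup 3P_1^{\ge 0}\}.$$
   Context: $3P_1^{\ge 0}=\{3k: k\in P_1^{\ge 0}\}$. *)

theory Defs
  imports "HOL-Number_Theory.Number_Theory"
begin

definition fair_game3 :: "int \<Rightarrow> int \<Rightarrow> int \<Rightarrow> bool" where
  "fair_game3 x1 x2 x3 \<longleftrightarrow>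
     x1 \<ge> 0 \<and> x2 \<ge> 0 \<and> x3 \<ge> 0 \<and>
     (x1 + x2 + x3)^2 - (x1 + x2 + x3) - 4 * (x1 * x2 + x1 * x3 + x2 * x3) = 0"

definition C3 :: "int set" where
  "C3 = {c. \<exists>x1 x2 x3. fair_game3 x1 x2 x3 \<and> (c = x1 \<or> c = x2 \<or> c = x3)}"

text \<open>The set written \<open>P\<^sub>1\<close> with superscript \<open>\<ge> 0\<close> in the mathematics; it contains 1 vacuously.\<close>

definition P1 :: "int set" where
  "P1 = {k. k > 0 \<and> (\<forall>p. prime p \<and> p dvd k \<longrightarrow> [p = 1] (mod 3))}"

definition three_P1 :: "int set" where
  "three_P1 = {3 * k | k. k \<in> P1}"

end

theory Submission
  imports Defs
begin

text \<open>
  For a fixed coordinate \<open>c\<close>, writing \<open>s\<close> and \<open>d\<close> for the sum and the difference of the other two,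
  the fairness equation becomes \<open>d\<^sup>2 + c\<^sup>2 - c = (2 c + 1) s\<close>. Parity of \<open>s - d\<close> is automatic, and
  nonnegativity can be forced by enlarging \<open>d\<close> modulo \<open>2 c + 1\<close>, so \<open>c\<close> is a coordinate of a fair
  game iff \<open>2 c + 1\<close> divides \<open>4 d\<^sup>2 + 3\<close> for some \<open>d\<close>, that is, iff \<open>-3\<close> is a square modulo the odd
  number \<open>2 c + 1\<close>. A prime other than 2 and 3 admits a square root of \<open>-3\<close> iff it is
  1 modulo 3, the number 9 does not divide \<open>4 d\<^sup>2 + 3\<close>, and solutions lift from \<open>n\<close> to \<open>n p\<close>, by
  Hensel's lemma if \<open>p\<close> divides \<open>n\<close> and by the Chinese remainder theorem otherwise.
\<close>

section \<open>Fair games and divisibility\<close>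

lemma fair_game3_iff:
  "fair_game3 a b c \<longleftrightarrow>
     a \<ge> 0 \<and> b \<ge> 0 \<and> c \<ge> 0 \<and> (a - b)\<^sup>2 + c\<^sup>2 - c = (2 * c + 1) * (a + b)"
  unfolding fair_game3_def by (auto simp: power2_eq_square algebra_simps)

lemma fair_game3_rotate: "fair_game3 a b c \<longleftrightarrow> fair_game3 b c a"
  unfolding fair_game3_def by (auto simp: algebra_simps)

lemma C3_iff_last: "c \<in> C3 \<longleftrightarrow> (\<exists>a b. fair_game3 a b c)"
  unfolding C3_def using fair_game3_rotate by blast

lemma C3_iff_dvd: "c \<in> C3 \<longleftrightarrow> c \<ge> 0 \<and> (\<exists>d. 2 * c + 1 dvd 4 * d\<^sup>2 + 3)"
proof (intro iffI conjI)
  assume "c \<in> C3"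
  then obtain a b where "fair_game3 a b c"
    unfolding C3_iff_last by blast
  then have c: "c \<ge> 0" and eq: "(a - b)\<^sup>2 + c\<^sup>2 - c = (2 * c + 1) * (a + b)"
    unfolding fair_game3_iff by auto
  show "c \<ge> 0" by (fact c)
  \<comment> \<open>Rests on the factorization
    \<open>4 * (c\<^sup>2 - c) - 3 = (2 * c + 1) * (2 * c - 3)\<close>.\<close>
  have "4 * (a - b)\<^sup>2 + 3 = 4 * ((a - b)\<^sup>2 + c\<^sup>2 - c) - (2 * c + 1) * (2 * c - 3)"
    by (simp add: power2_eq_square algebra_simps)
  also have "\<dots> = (2 * c + 1) * (4 * (a + b) - (2 * c - 3))"
    unfolding eq by (simp add: algebra_simps)
  finally show "\<exists>d. 2 * c + 1 dvd 4 * d\<^sup>2 + 3"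
    by (metis dvd_triv_left)
next
  assume "c \<ge> 0 \<and> (\<exists>d. 2 * c + 1 dvd 4 * d\<^sup>2 + 3)"
  then obtain d0 where c: "c \<ge> 0" and d0: "2 * c + 1 dvd 4 * d0\<^sup>2 + 3"
    by blast
  define n where "n = 2 * c + 1"
  \<comment> \<open>The summand \<open>n\<close> makes \<open>d\<close> at least \<open>n\<close>
    without changing its residue. Then \<open>n * s \<ge> d\<^sup>2 \<ge> n * d\<close>, so
    \<open>s \<ge> d\<close> and both \<open>(s + d) / 2\<close> and \<open>(s - d) / 2\<close> are
    nonnegative.\<close>
  define d where "d = d0 mod n + n"
  have n: "n > 0" "odd n"
    using c by (auto simp: n_def)
  have "d \<ge> n"
    using n by (simp add: d_def)
  have "[4 * d\<^sup>2 + 3 = 4 * d0\<^sup>2 + 3] (mod n)"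
    unfolding d_def by (intro cong_add cong_mult cong_pow cong_refl) (simp add: cong_def)
  then have "n dvd 4 * d\<^sup>2 + 3"
    using d0 cong_dvd_iff unfolding n_def by blast
  moreover have "4 * (d\<^sup>2 + c\<^sup>2 - c) = 4 * d\<^sup>2 + 3 + n * (2 * c - 3)"
    unfolding n_def by (simp add: power2_eq_square algebra_simps)
  ultimately have "n dvd 4 * (d\<^sup>2 + c\<^sup>2 - c)"
    by (metis dvd_add dvd_triv_left)
  moreover have "coprime n (2 ^ 2)"
    using n by (subst coprime_power_right_iff) simp
  ultimately have "n dvd d\<^sup>2 + c\<^sup>2 - c"
    using coprime_dvd_mult_right_iff[of n "2 ^ 2" "d\<^sup>2 + c\<^sup>2 - c"] by simp
  then obtain s where s: "d\<^sup>2 + c\<^sup>2 - c = n * s"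
    by blast
  \<comment> \<open>\<open>c\<^sup>2 - c\<close> is always even and \<open>n\<close> is odd, so
    \<open>s\<close> inherits the parity of \<open>d\<close>.\<close>
  have "even (d\<^sup>2 + c\<^sup>2 - c) \<longleftrightarrow> even d"
    by auto
  then have "even s \<longleftrightarrow> even d"
    using n s by auto
  then have "even (s + d)"
    by simp
  then obtain a where a: "s + d = 2 * a"
    by blast
  have "n * d \<le> d * d"
    using \<open>d \<ge> n\<close> n by (simp add: mult_right_mono)
  moreover have "c \<le> c * c"
    using c by (cases "c = 0") auto
  ultimately have "n * d \<le> n * s"
    using s by (simp add: power2_eq_square)
  then have "d \<le> s"
    using n by simp
  then have "fair_game3 a (a - d) c"
    unfolding fair_game3_iff using c a n \<open>d \<ge> n\<close> s
    by (auto simp: n_def)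
  then show "c \<in> C3"
    unfolding C3_iff_last by blast
qed

section \<open>Square roots of -3 modulo a prime\<close>

lemma prime_dvd_square_add_3:
  fixes p :: nat and x :: int
  assumes "prime p" and "p \<noteq> 2" and "p \<noteq> 3" and dvd: "int p dvd x\<^sup>2 + 3"
  shows "p mod 3 = 1"
proof (rule ccontr)
  assume ne: "p mod 3 \<noteq> 1"
  have p: "prime (int p)"
    using \<open>prime p\<close> by simp
  \<comment> \<open>12 is the value of \<open>x\<^sup>2 + 3\<close> at \<open>x = 3\<close>, the
    residue to which \<open>x\<close> is forced below.\<close>
  have not_dvd: "\<not> int p dvd 12"
  proof
    assume "int p dvd 12"
    then have "p dvd 2 * 2 * 3"
      by (metis int_dvd_int_iff mult.assoc num_double numeral_times_numeral of_nat_numeral)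
    then have "p dvd 2 \<or> p dvd 3"
      using \<open>prime p\<close> prime_dvd_mult_iff by metis
    then show False
      using \<open>prime p\<close> \<open>p \<noteq> 2\<close> \<open>p \<noteq> 3\<close> using primes_dvd_imp_eq[of p 2] primes_dvd_imp_eq[of p 3] by auto
  qed
  have "p mod 3 \<noteq> 0"
    using \<open>prime p\<close> \<open>p \<noteq> 3\<close> primes_dvd_imp_eq[of 3 p] by (auto simp: mod_eq_0_iff_dvd)
  with ne have "p mod 3 = 2"
    by linarith
  then obtain k where k: "p = 3 * k + 2"
    by (metis mult_div_mod_eq)
  \<comment> \<open>\<open>(x - 1) / 2\<close> is a cube root of unity modulo \<open>p\<close>\<close>
  have "(x - 1) ^ 3 - 2 ^ 3 = (x\<^sup>2 + 3) * (x - 3)"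
    by (simp add: power2_eq_square power3_eq_cube algebra_simps)
  then have cube: "[(x - 1) ^ 3 = 2 ^ 3] (mod int p)"
    using dvd by (simp add: cong_iff_dvd_diff)
  have p2: "\<not> int p dvd 2"
    using not_dvd dvd_trans[of "int p" 2 12] by auto
  have p8: "\<not> int p dvd 2 ^ 3"
    using p2 p prime_dvd_power by blast
  then have "\<not> int p dvd (x - 1) ^ 3"
    using cube cong_dvd_iff by blast
  then have px: "\<not> int p dvd x - 1"
    using prime_dvd_power_iff[OF p, of 3 "x - 1"] by simp
  have fermat: "[y ^ (3 * k + 1) = 1] (mod int p)" if "\<not> int p dvd y" for y
  proof -
    define a where "a = nat (y mod int p)"
    have a: "int a = y mod int p"
      using prime_gt_0_int[OF p] by (simp add: a_def)
    then have "\<not> p dvd a"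
      using that by (metis dvd_mod_iff dvd_refl int_dvd_int_iff)
    then have "[int a ^ (p - 1) = 1] (mod int p)"
      using fermat_theorem[OF \<open>prime p\<close>] by (simp flip: cong_int_iff)
    moreover have "[int a ^ (p - 1) = y ^ (p - 1)] (mod int p)"
      unfolding a by (intro cong_pow) simp
    moreover have "p - 1 = 3 * k + 1"
      using k by simp
    ultimately show ?thesis
      using cong_sym cong_trans by metis
  qed
  \<comment> \<open>As \<open>p - 1 = 3 * k + 1\<close>, Fermat gives
    \<open>y * (y ^ 3) ^ k = 1\<close> for every unit \<open>y\<close>, so a unit is determined by
    its cube. Here 2 and \<open>x - 1\<close> have the same cube.\<close>
  have "[2 * 8 ^ k = (x - 1) * (8::int) ^ k] (mod int p)"
  proof -
    have "[(2::int) * 8 ^ k = 1] (mod int p)"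
      using fermat[OF p2] by (simp add: power_mult)
    moreover have "[(x - 1) * ((x - 1) ^ 3) ^ k = 1] (mod int p)"
      using fermat[OF px] by (simp add: power_mult)
    moreover have "[(x - 1) * ((x - 1) ^ 3) ^ k = (x - 1) * (2 ^ 3) ^ k] (mod int p)"
      by (intro cong_mult cong_pow cong_refl cube)
    ultimately show ?thesis
      by (simp add: cong_def)
  qed
  moreover have "coprime ((8::int) ^ k) (int p)"
    using prime_imp_coprime[OF p p8] by (simp add: coprime_commute)
  ultimately have "[2 = x - 1] (mod int p)"
    by (simp add: cong_mult_rcancel)
  then have "[x = 3] (mod int p)"
    using cong_add[of 2 "x - 1" "int p" 1 1] by (simp add: cong_sym)
  then have "[x\<^sup>2 + 3 = 3\<^sup>2 + 3] (mod int p)"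
    by (intro cong_add cong_pow cong_refl)
  then show False
    using dvd not_dvd cong_dvd_iff by fastforce
qed

text \<open>A primitive root raised to the power \<open>(p - 1) / 3\<close> is a cube root of unity
  \<open>u\<close> other than 1, hence a root of \<open>u\<^sup>2 + u + 1\<close>. Completing the
  square makes \<open>2 * u + 1\<close> a square root of -3.\<close>

lemma prime_cong_1_mod_3_imp_dvd_square_add_3:
  fixes p :: nat
  assumes "prime p" and "p mod 3 = 1"
  shows "\<exists>x. int p dvd x\<^sup>2 + 3"
proof -
  define k where "k = p div 3"
  have k: "p = 3 * k + 1"
    using assms by (metis k_def mult_div_mod_eq)
  have "k > 0"
    using k \<open>prime p\<close> by (cases k) auto
  obtain g where "residue_primroot p g"
    using prime_primitive_root_exists[of p] \<open>prime p\<close> prime_gt_1_nat by auto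
  then have ord: "ord p g = 3 * k"
    using \<open>prime p\<close> k by (auto simp: residue_primroot_def totient_prime)
  define u where "u = int (g ^ k)"
  have "[g ^ (3 * k) = 1] (mod p)" and "\<not> [g ^ k = 1] (mod p)"
    unfolding ord_divides ord using \<open>k > 0\<close> by (auto dest!: dvd_imp_le)
  then have "[u ^ 3 = 1] (mod int p)" and "\<not> [u = 1] (mod int p)"
    unfolding u_def by (auto simp flip: cong_int_iff simp: power_mult mult.commute)
  then have "int p dvd (u - 1) * (u\<^sup>2 + u + 1)" and "\<not> int p dvd u - 1"
    by (auto simp: cong_iff_dvd_diff power2_eq_square power3_eq_cube algebra_simps)
  then have "int p dvd u\<^sup>2 + u + 1"
    using \<open>prime p\<close> by (simp add: prime_dvd_mult_iff)
  then have "int p dvd 4 * (u\<^sup>2 + u + 1)"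
    by (rule dvd_mult)
  also have "4 * (u\<^sup>2 + u + 1) = (2 * u + 1)\<^sup>2 + 3"
    by (simp add: power2_eq_square algebra_simps)
  finally show ?thesis by blast
qed

section \<open>Lifting square roots of -3 to composite moduli\<close>

lemma lift_dvd_square_add_3:
  fixes p n x z :: int
  assumes "prime p" and "p \<noteq> 2" and "p \<noteq> 3"
    and x: "n dvd x\<^sup>2 + 3" and z: "p dvd z\<^sup>2 + 3"
  shows "\<exists>x. n * p dvd x\<^sup>2 + 3"
proof (cases "p dvd n")
  case False
  then have "coprime n p"
    using \<open>prime p\<close> prime_imp_coprime coprime_commute by blast
  then obtain y where "[y = x] (mod n)" "[y = z] (mod p)"
    using binary_chinese_remainder_int by blast
  then have "[y\<^sup>2 + 3 = x\<^sup>2 + 3] (mod n)" "[y\<^sup>2 + 3 = z\<^sup>2 + 3] (mod p)"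
    by (auto intro!: cong_add cong_pow)
  then have "n dvd y\<^sup>2 + 3" "p dvd y\<^sup>2 + 3"
    using x z by (simp_all add: cong_dvd_iff)
  then show ?thesis
    using \<open>coprime n p\<close> divides_mult by blast
next
  case True
  obtain t where t: "x\<^sup>2 + 3 = n * t"
    using x by blast
  have "\<not> p dvd 2" "\<not> p dvd 3"
    using assms primes_dvd_imp_eq[of p 2] primes_dvd_imp_eq[of p 3] by auto
  moreover have "\<not> p dvd x"
  proof
    assume "p dvd x"
    then have "p dvd x\<^sup>2"
      by (simp add: power2_eq_square)
    then show False
      using True x \<open>\<not> p dvd 3\<close> by (metis dvd_add_right_iff dvd_trans)
  qed
  ultimately have "\<not> p dvd 2 * x"
    using \<open>prime p\<close> by (simp add: prime_dvd_mult_iff)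
  then have "coprime (2 * x) p"
    using \<open>prime p\<close> prime_imp_coprime coprime_commute by blast
  \<comment> \<open>Newton correction: \<open>(x + n * y)\<^sup>2 + 3\<close> is \<open>n\<close>
    times \<open>t + 2 * x * y + n * y\<^sup>2\<close>, whose last term vanishes modulo
    \<open>p\<close> because \<open>p\<close> divides \<open>n\<close>.\<close>
  then obtain y where "[2 * x * y = - t] (mod p)"
    using cong_solve_dvd_int[of "2 * x" p "- t"] by auto
  then have "p dvd t + 2 * x * y + n * y\<^sup>2"
    using True by (simp add: cong_iff_dvd_diff add.commute)
  then have "n * p dvd n * (t + 2 * x * y + n * y\<^sup>2)"
    by (rule mult_dvd_mono[OF dvd_refl])
  also have "n * (t + 2 * x * y + n * y\<^sup>2) = (x + n * y)\<^sup>2 + 3"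
    using t by (simp add: power2_eq_square algebra_simps)
  finally show ?thesis by blast
qed

text \<open>Prime factors of \<open>m\<close> are lifted one at a time, starting from modulus 3 with
  root 0. Carrying the factor 3 along settles the moduli \<open>m\<close> and \<open>3 * m\<close>
  together.\<close>

lemma three_mult_dvd_square_add_3:
  fixes m :: int
  assumes "\<And>p. prime p \<Longrightarrow> p dvd m \<Longrightarrow> [p = 1] (mod 3)"
  shows "\<exists>x. 3 * m dvd x\<^sup>2 + 3"
  using assms
proof (induction m rule: prime_divisors_induct)
  case zero
  \<comment> \<open>Zero is excluded: 2 divides it and is not 1 modulo 3.\<close>
  from zero[of 2] show ?case
    by (simp add: cong_def)
next
  case (unit m)
  then have "3 * m dvd 0\<^sup>2 + 3"
    by auto
  then show ?case by blast
next
  case (factor p m)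
  have p3: "[p = 1] (mod 3)"
    using factor by simp
  then have "p \<noteq> 2" "p \<noteq> 3"
    by (auto simp: cong_def)
  have "prime (nat p)" "p \<ge> 0"
    using factor.hyps prime_int_nat_transfer by blast+
  then have "nat p mod 3 = 1"
    using p3 nat_mod_distrib[of p 3] by (simp add: cong_def)
  then obtain z where "p dvd z\<^sup>2 + 3"
    using prime_cong_1_mod_3_imp_dvd_square_add_3[OF \<open>prime (nat p)\<close>] \<open>p \<ge> 0\<close> by auto
  moreover obtain x where "3 * m dvd x\<^sup>2 + 3"
    using factor by auto
  ultimately obtain y where "3 * m * p dvd y\<^sup>2 + 3"
    using lift_dvd_square_add_3 factor.hyps \<open>p \<noteq> 2\<close> \<open>p \<noteq> 3\<close> by blast
  then show ?case
    by (auto simp: ac_simps)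
qed

section \<open>Odd divisors of \<open>4 * d\<^sup>2 + 3\<close>\<close>

text \<open>For odd \<open>n\<close>, one of \<open>x\<close> and \<open>x + n\<close> is even and
  can be halved.\<close>

lemma dvd_square_add_3_imp_dvd_four_square_add_3:
  fixes n x :: int
  assumes "odd n" and "n dvd x\<^sup>2 + 3"
  shows "\<exists>d. n dvd 4 * d\<^sup>2 + 3"
proof -
  define y where "y = (if even x then x else x + n)"
  have "[y\<^sup>2 + 3 = x\<^sup>2 + 3] (mod n)"
    unfolding y_def by (intro cong_add cong_pow cong_refl) (simp add: cong_def)
  then have "n dvd y\<^sup>2 + 3"
    using assms cong_dvd_iff by blast
  moreover have "even y"
    using assms by (simp add: y_def)
  then obtain d where "y = 2 * d"
    by blast
  ultimately show ?thesis
    by (auto simp: power_mult_distrib)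
qed

lemma dvd_four_square_add_3_iff:
  fixes n :: int
  assumes "odd n" and "n > 0"
  shows "(\<exists>d. n dvd 4 * d\<^sup>2 + 3) \<longleftrightarrow> n \<in> P1 \<union> three_P1"
proof
  assume "\<exists>d. n dvd 4 * d\<^sup>2 + 3"
  then obtain d where d: "n dvd (2 * d)\<^sup>2 + 3"
    by (auto simp: power_mult_distrib)
  \<comment> \<open>Applied to \<open>n\<close> itself if 3 does not divide it, and to
    \<open>n / 3\<close> otherwise.\<close>
  have P1: "k \<in> P1" if "k dvd n" "\<not> 3 dvd k" "k > 0" for k
    unfolding P1_def
  proof (safe intro!: \<open>k > 0\<close>)
    fix p :: int
    assume p: "prime p" "p dvd k"
    then have "prime (nat p)" "p \<ge> 0"
      using prime_int_nat_transfer by blast+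
    have "p \<noteq> 3" "p \<noteq> 2"
      using p that \<open>odd n\<close> dvd_trans by blast+
    have "p dvd (2 * d)\<^sup>2 + 3"
      using p that d dvd_trans by blast
    then have "nat p mod 3 = 1"
      using prime_dvd_square_add_3[of "nat p" "2 * d"] \<open>prime (nat p)\<close> \<open>p \<ge> 0\<close> \<open>p \<noteq> 2\<close> \<open>p \<noteq> 3\<close>
      by auto
    then show "[p = 1] (mod 3)"
      using \<open>p \<ge> 0\<close> nat_mod_distrib[of p 3] by (simp add: cong_def nat_eq_iff split: if_splits)
  qed
  show "n \<in> P1 \<union> three_P1"
  proof (cases "3 dvd n")
    case False
    then show ?thesis
      using P1 \<open>n > 0\<close> by auto
  next
    case True
    then obtain k where k: "n = 3 * k"
      by blast
    \<comment> \<open>Otherwise 9 divides \<open>(2 * d)\<^sup>2 + 3\<close>; then 3 divides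
      \<open>2 * d\<close>, so 9 divides the square and hence 3.\<close>
    have "\<not> 3 dvd k"
    proof
      assume "3 dvd k"
      then have "9 dvd (2 * d)\<^sup>2 + 3"
        using d k by (auto elim!: dvdE simp: mult.assoc)
      then have "3 dvd (2 * d)\<^sup>2 + 3"
        by (rule dvd_trans[rotated]) simp
      then have "3 dvd (2 * d)\<^sup>2"
        using dvd_add_left_iff[of 3 3 "(2 * d)\<^sup>2"] by simp
      then have "3 dvd 2 * d"
        by (rule prime_dvd_power[rotated]) simp
      then have "3\<^sup>2 dvd (2 * d)\<^sup>2"
        by (rule dvd_power_same)
      then have "(9::int) dvd 3"
        using \<open>9 dvd (2 * d)\<^sup>2 + 3\<close> dvd_add_right_iff[of 9 "(2 * d)\<^sup>2" 3] by simp
      then show False by simp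
    qed
    then have "k \<in> P1"
      using P1[of k] k \<open>n > 0\<close> by simp
    then show ?thesis
      using k by (auto simp: three_P1_def)
  qed
next
  assume "n \<in> P1 \<union> three_P1"
  then obtain m where m: "m \<in> P1" "n = m \<or> n = 3 * m"
    by (auto simp: three_P1_def)
  obtain x where "3 * m dvd x\<^sup>2 + 3"
    using three_mult_dvd_square_add_3[of m] m(1) by (auto simp: P1_def)
  moreover have "n dvd 3 * m"
    using m(2) by auto
  ultimately have "n dvd x\<^sup>2 + 3"
    by (rule dvd_trans[rotated])
  then show "\<exists>d. n dvd 4 * d\<^sup>2 + 3"
    using dvd_square_add_3_imp_dvd_four_square_add_3 \<open>odd n\<close> by blast
qed

theorem theorem5p4:
  shows "C3 = {c. c \<ge> 0 \<and> 2 * c + 1 \<in> P1 \<union> three_P1}"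
proof (rule Set.set_eqI)
  fix c :: int
  show "c \<in> C3 \<longleftrightarrow> c \<in> {c. c \<ge> 0 \<and> 2 * c + 1 \<in> P1 \<union> three_P1}"
    unfolding C3_iff_dvd mem_Collect_eq
    by (intro conj_cong refl dvd_four_square_add_3_iff) auto
qed

end
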